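(* Let $A\in\mathbb{Z}^{m\times n}$, $A\ne0$, let $F$ be a $\mathrm{td}$-decomposition of $G_D(A)$, and let $$K:=\max_{P\text{ root-leaf path in }F}\ \prod_{i=1}^{\mathrm{th}(F)}\bigl(k_i(P)+1\bigr).$$ Then $g_1(A)\le(3\|A\|_\infty K)^{K-1}$.
   Context: $\|A\|_\infty$ is the largest absolute value of an entry of $A$. For $x,y\in\mathbb{R}^n$ write $x\sqsubseteq y$ if $x_iy_i\ge0$ and $|x_i|\le|y_i|$ for all $i$. The Graver basis $\mathcal{G}(A)$ is the (finite) set of $\sqsubseteq$-minimal elements of $\{x\in\mathbb{Z}^n\mid Ax=\mathbf{0}\}\setminus\{\mathbf{0}\}$, and $g_1(A):=\max_{g\in\mathcal{G}(A)}\|g\|_1$ (interpreted as $0$ if $\mathcal{G}(A)=\emptyset$). The dual graph $G_D(A)$ has the rows of $A$ as vertices, with two distinct rows adjacent iff some column is nonzero in both; it is assumed connected. A $\mathrm{td}$-decomposition of a graph $G$ is a rooted tree $F$ on $V(G)$ such that every edge of $G$ joins two vertices in ancestor-descendant relationship in $F$. A vertex of $F$ is degenerate if it has exactly one child and non-degenerate otherwise (a leaf or at least two children); the topological height $\mathrm{th}(F)$ is the maximum number of non-degenerate vertices on a root-leaf path of $F$. For a root-leaf path $P$ starting at the root $v_{b(0)}$ and with non-degenerate vertices $v_{b(1)},\dots,v_{b(e)}$ in order from the root (possibly $v_{b(0)}=v_{b(1)}$), $k_1(P)$ is the number of vertices of $P$ from $v_{b(0)}$ to $v_{b(1)}$ inclusive;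 for $2\le i\le e$, $k_i(P)$ is the number of vertices of $P$ from $v_{b(i-1)}$ to $v_{b(i)}$ inclusive minus one; and $k_i(P):=0$ for $i>e$. *)

theory Defs
  imports
    "Jordan_Normal_Form.Matrix_Kernel"
    "Graph_Theory.Digraph_Component"
    "Graph_Theory.Vertex_Walk"
begin

definition linf_norm_mat :: "int mat \<Rightarrow> int" where
  "linf_norm_mat A = Max (abs ` elements_mat A)"

definition l1_norm_vec :: "int vec \<Rightarrow> int" where
  "l1_norm_vec x = (\<Sum>i<dim_vec x. \<bar>x $ i\<bar>)"

definition conformal_le :: "'a::linordered_idom vec \<Rightarrow> 'a vec \<Rightarrow> bool" where
  "conformal_le x y \<longleftrightarrow> dim_vec x = dim_vec y \<and>
     (\<forall>i<dim_vec y. x $ i * y $ i \<ge> 0 \<and> \<bar>x $ i\<bar> \<le> \<bar>y $ i\<bar>)"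

definition graver_basis :: "int mat \<Rightarrow> int vec set" where
  "graver_basis A =
     (let S = mat_kernel A - {0\<^sub>v (dim_col A)}
      in {g \<in> S. \<forall>h\<in>S. conformal_le h g \<longrightarrow> h = g})"

definition g1 :: "int mat \<Rightarrow> int" where
  "g1 A = (if graver_basis A = {} then 0 else Max (l1_norm_vec ` graver_basis A))"

(* Undirected graphs are symmetric digraphs, as usual in Graph_Theory. *)
definition dual_graph :: "'a::zero mat \<Rightarrow> nat pair_pre_digraph" where
  "dual_graph A = \<lparr> pverts = {..<dim_row A},
     parcs = {(i, j). i < dim_row A \<and> j < dim_row A \<and> i \<noteq> j \<and>
                (\<exists>c<dim_col A. A $$ (i, c) \<noteq> 0 \<and> A $$ (j, c) \<noteq> 0)} \<rparr>"

(* Arcs point from parent to child. The library predicate tree is not suitable here: it only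
   excludes directed cycles, so for instance a transitive triangle satisfies it. *)
definition rooted_tree :: "'v pair_pre_digraph \<Rightarrow> 'v \<Rightarrow> bool" where
  "rooted_tree F r \<longleftrightarrow> pair_fin_digraph F \<and> r \<in> pverts F \<and>
     (\<forall>v\<in>pverts F. \<exists>!p. pre_digraph.awalk (with_proj F) r p v)"

definition td_decomposition ::
    "'v pair_pre_digraph \<Rightarrow> 'v pair_pre_digraph \<Rightarrow> 'v \<Rightarrow> bool" where
  "td_decomposition G F r \<longleftrightarrow> rooted_tree F r \<and> pverts F = pverts G \<and>
     (\<forall>(u, v)\<in>parcs G. u \<rightarrow>\<^sup>*\<^bsub>with_proj F\<^esub> v \<or> v \<rightarrow>\<^sup>*\<^bsub>with_proj F\<^esub> u)"

definition degenerate :: "'v pair_pre_digraph \<Rightarrow> 'v \<Rightarrow> bool" where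
  "degenerate F v \<longleftrightarrow> out_degree (with_proj F) v = 1"

definition root_leaf_paths :: "'v pair_pre_digraph \<Rightarrow> 'v \<Rightarrow> 'v list set" where
  "root_leaf_paths F r =
     {P. vpath P (with_proj F) \<and> hd P = r \<and> out_degree (with_proj F) (last P) = 0}"

definition topological_height :: "'v pair_pre_digraph \<Rightarrow> 'v \<Rightarrow> nat" where
  "topological_height F r =
     Max ((\<lambda>P. length (filter (\<lambda>v. \<not> degenerate F v) P)) ` root_leaf_paths F r)"

(* The indices b(1) < ... < b(e) along P; list positions are 0-based, so b(1) is entry 0. *)
definition nondegenerate_positions :: "'v pair_pre_digraph \<Rightarrow> 'v list \<Rightarrow> nat list" where
  "nondegenerate_positions F P = filter (\<lambda>j. \<not> degenerate F (P ! j)) [0..<length P]"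

(* The value at i = 0 is a dummy; the segments are numbered from 1. *)
definition segment_length :: "'v pair_pre_digraph \<Rightarrow> 'v list \<Rightarrow> nat \<Rightarrow> nat" where
  "segment_length F P i =
     (let bs = nondegenerate_positions F P; b = (\<lambda>l. bs ! (l - 1)); e = length bs
      in if i = 0 \<or> i > e then 0
         else if i = 1 then card {0..b 1}
         else card {b (i - 1)..b i} - 1)"

end

theory Submission
  imports Defs
begin

text \<open>
  Induct along the tree. Let \<open>k\<close> be the number of rows down to the first branching
  vertex. The rows below it form a matrix whose columns split into blocks, one for each child
  subtree, so every Graver element of the lower part is a Graver element of one block (or a unit
  vector) and inductively has norm at most some \<open>B\<close>. Write a Graver element \<open>x\<close> of the whole
  matrix as a conformal sum of Graver elements of the lower part. The top rows map the summands
  to vectors of norm at most \<open>\<parallel>A\<parallel> B\<close> summing to \<open>0\<close>; by Steinitz' lemma they can be ordered so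
  that all partial sums have norm at most \<open>k \<parallel>A\<parallel> B\<close>. No partial sum repeats, since the summands
  in between would add up to a kernel element strictly below \<open>x\<close>. Counting integer points in
  the box bounds the norm of \<open>x\<close> by \<open>B (2 k \<parallel>A\<parallel> B + 1) ^ k\<close>.
\<close>

section \<open>Steinitz' lemma\<close>

text \<open>Gaussian elimination, one equation at a time: a pivot variable \<open>j\<close> of
  equation \<open>e\<close> is removed from the other equations, which again leaves fewer equations
  than variables.\<close>

lemma homogeneous_system_nontrivial:
  fixes a :: "'e \<Rightarrow> 'i \<Rightarrow> 'a::field"
  assumes "finite E" "finite I" "card E < card I"
  shows "\<exists>v. (\<exists>i\<in>I. v i \<noteq> 0) \<and> (\<forall>e\<in>E. (\<Sum>i\<in>I. a e i * v i) = 0)"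
  using assms
proof (induction E arbitrary: I a rule: finite_induct)
  case empty
  then obtain i where "i \<in> I" by (metis card.empty less_irrefl all_not_in_conv)
  then show ?case by (auto intro!: exI[of _ "\<lambda>_. 1"])
next
  case (insert e E)
  show ?case
  proof (cases "\<forall>i\<in>I. a e i = 0")
    case True
    moreover obtain v where "\<exists>i\<in>I. v i \<noteq> 0" "\<forall>e\<in>E. (\<Sum>i\<in>I. a e i * v i) = 0"
      using insert.IH[of I a] insert.prems insert.hyps by auto
    ultimately show ?thesis by (intro exI[of _ v]) auto
  next
    case False
    then obtain j where j: "j \<in> I" "a e j \<noteq> 0" by auto
    define I' where "I' = I - {j}"
    have I: "I = insert j I'" "j \<notin> I'" "finite I'"
      using j insert.prems by (auto simp: I'_def)
    \<comment> \<open>Subtracting \<open>a f j / a e j\<close> times equation \<open>e\<close>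
      cancels the pivot variable in equation \<open>f\<close>. For \<open>f = e\<close> nothing
      remains.\<close>
    define a' where "a' = (\<lambda>f i. a f i - a f j * a e i / a e j)"
    have "card E < card I'" using insert.prems insert.hyps I by auto
    then obtain v where v: "\<exists>i\<in>I'. v i \<noteq> 0" "\<forall>f\<in>E. (\<Sum>i\<in>I'. a' f i * v i) = 0"
      using insert.IH[of I' a'] I by auto
    \<comment> \<open>The value at \<open>j\<close> is solved from equation \<open>e\<close>; with
      it, every original equation at \<open>w\<close> becomes the reduced equation at
      \<open>v\<close>.\<close>
    define w where "w = v(j := - (\<Sum>i\<in>I'. a e i * v i) / a e j)"
    have split: "(\<Sum>i\<in>I. a f i * w i) = (\<Sum>i\<in>I'. a' f i * v i)" for f
    proof -
      have "(\<Sum>i\<in>I. a f i * w i) = a f j * w j + (\<Sum>i\<in>I'. a f i * w i)"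
        using I by simp
      also have "(\<Sum>i\<in>I'. a f i * w i) = (\<Sum>i\<in>I'. a f i * v i)"
        using I by (intro sum.cong) (auto simp: w_def)
      also have "a f j * w j = - (\<Sum>i\<in>I'. a f j * a e i / a e j * v i)"
        by (simp add: w_def sum_distrib_left sum_divide_distrib mult.assoc)
      finally show ?thesis
        by (simp add: a'_def algebra_simps sum_subtractf)
    qed
    have "(\<Sum>i\<in>I. a e i * w i) = 0" unfolding split a'_def using j(2) by simp
    moreover have "\<exists>i\<in>I. w i \<noteq> 0" using v(1) I unfolding w_def by auto
    ultimately show ?thesis using v(2) split by (intro exI[of _ w]) auto
  qed
qed

text \<open>A vertex of the polytope cut out of the unit cube by \<open>card E + 1\<close> equations
  has at most that many fractional coordinates. Instead of choosing a vertex, the proof moves along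
  a homogeneous solution supported on the fractional coordinates until one more of them reaches 0 or
  1.\<close>

lemma exists_weights_few_fractional:
  fixes x :: "'i \<Rightarrow> 'e \<Rightarrow> real"
  assumes "finite A" "finite E"
    and "\<forall>i\<in>A. 0 \<le> u i \<and> u i \<le> 1" and "\<forall>e\<in>E. (\<Sum>i\<in>A. u i * x i e) = 0"
  shows "\<exists>w. (\<forall>i\<in>A. 0 \<le> w i \<and> w i \<le> 1) \<and> (\<forall>e\<in>E. (\<Sum>i\<in>A. w i * x i e) = 0) \<and>
    sum w A = sum u A \<and> card {i\<in>A. 0 < w i \<and> w i < 1} \<le> Suc (card E)"
  using assms(3,4)
proof (induction "card {i\<in>A. 0 < u i \<and> u i < 1}" arbitrary: u rule: less_induct)
  case less
  define I where "I = {i\<in>A. 0 < u i \<and> u i < 1}"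
  show ?case
  proof (cases "card I \<le> Suc (card E)")
    case True
    then show ?thesis using less.prems unfolding I_def by (intro exI[of _ u]) auto
  next
    case False
    \<comment> \<open>The index \<^term>\<open>None\<close> stands for the extra equation that preserves the sum of the weights.\<close>
    define E' where "E' = insert None (Some ` E)"
    define a where "a = (\<lambda>f i. case f of None \<Rightarrow> 1 | Some e \<Rightarrow> x i e)"
    have "finite I" "I \<subseteq> A" using assms(1) by (auto simp: I_def)
    have "card E' = Suc (card E)"
      using assms(2) by (simp add: E'_def card_image)
    then obtain v where v: "\<exists>i\<in>I. v i \<noteq> 0" "\<forall>f\<in>E'. (\<Sum>i\<in>I. a f i * v i) = 0"
      using homogeneous_system_nontrivial[of E' I a] False \<open>finite I\<close> assms(2)
      by (auto simp: E'_def)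
    have v0: "(\<Sum>i\<in>I. v i) = 0" using v(2) by (auto simp: E'_def a_def)
    have vE: "(\<Sum>i\<in>I. v i * x i e) = 0" if "e \<in> E" for e
      using v(2) that by (auto simp: E'_def a_def mult.commute)
    define J where "J = {i\<in>I. v i \<noteq> 0}"
    have J: "finite J" "J \<noteq> {}" using \<open>finite I\<close> v(1) by (auto simp: J_def)
    \<comment> \<open>\<open>s i\<close> is how far one can move in direction \<open>v\<close>
      before coordinate \<open>i\<close> leaves the unit interval. The minimum \<open>t\<close> is
      attained at some \<open>j\<close>, and that coordinate ends at exactly 0 or 1.\<close>
    define s where "s = (\<lambda>i. if v i > 0 then (1 - u i) / v i else u i / (- v i))"
    define t where "t = Min (s ` J)"
    have tle: "t \<le> s i" if "i \<in> J" for i using J that by (simp add: t_def)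
    have "t \<in> s ` J" using J unfolding t_def by (intro Min_in) auto
    then obtain j where j: "j \<in> J" "t = s j" by auto
    have "0 < s i" if "i \<in> J" for i
      using that unfolding s_def J_def I_def by (auto simp: divide_pos_neg)
    then have t0: "0 < t" using j by simp
    define w where "w = (\<lambda>i. if i \<in> I then u i + t * v i else u i)"
    have w_bounds: "0 \<le> u i + t * v i \<and> u i + t * v i \<le> 1" if "i \<in> I" for i
    proof -
      have ui: "0 < u i" "u i < 1" using that by (auto simp: I_def)
      consider "v i = 0" | "v i > 0" | "v i < 0" by linarith
      then show ?thesis
      proof cases
        case 1 then show ?thesis using ui by simp
      next
        case 2
        then have "t \<le> (1 - u i) / v i" using tle[of i] that by (auto simp: J_def s_def)
        then have "t * v i \<le> 1 - u i" using 2 by (simp add: pos_le_divide_eq)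
        moreover have "0 \<le> t * v i" using t0 2 by simp
        ultimately show ?thesis using ui by linarith
      next
        case 3
        then have "t \<le> u i / (- v i)" using tle[of i] that by (auto simp: J_def s_def)
        then have "t * (- v i) \<le> u i" using 3 pos_le_divide_eq[of "- v i" t "u i"] by simp
        moreover have "t * v i \<le> 0" using t0 3 by (simp add: mult_nonneg_nonpos)
        ultimately show ?thesis using ui by simp
      qed
    qed
    have w_sum: "(\<Sum>i\<in>A. w i * y i) = (\<Sum>i\<in>A. u i * y i)" if "(\<Sum>i\<in>I. v i * y i) = 0" for y
    proof -
      have "(\<Sum>i\<in>A. w i * y i) = (\<Sum>i\<in>A. u i * y i + (if i \<in> I then t * (v i * y i) else 0))"
        by (intro sum.cong) (auto simp: w_def algebra_simps)
      also have "\<dots> = (\<Sum>i\<in>A. u i * y i) + t * (\<Sum>i\<in>I. v i * y i)"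
        using assms(1) \<open>I \<subseteq> A\<close>
        by (simp add: sum.distrib sum.inter_restrict[symmetric] sum_distrib_left Int_absorb1)
      finally show ?thesis using that by simp
    qed
    have wj: "w j = 0 \<or> w j = 1" "j \<in> I"
      using j by (auto simp: w_def s_def J_def)
    have "{i\<in>A. 0 < w i \<and> w i < 1} \<subseteq> I"
      by (auto simp: w_def I_def split: if_splits)
    moreover have "j \<notin> {i\<in>A. 0 < w i \<and> w i < 1}" using wj(1) by auto
    ultimately have "{i\<in>A. 0 < w i \<and> w i < 1} \<subset> I" using wj(2) by blast
    then have "card {i\<in>A. 0 < w i \<and> w i < 1} < card I"
      using \<open>finite I\<close> by (rule psubset_card_mono[rotated])
    moreover have "\<forall>i\<in>A. 0 \<le> w i \<and> w i \<le> 1"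
      using w_bounds less.prems(1) by (auto simp: w_def)
    moreover have "\<forall>e\<in>E. (\<Sum>i\<in>A. w i * x i e) = 0"
      using w_sum vE less.prems(2) by simp
    moreover have "sum w A = sum u A" using w_sum[of "\<lambda>_. 1"] v0 by simp
    ultimately show ?thesis using less.hyps[of w] unfolding I_def by simp
  qed
qed

text \<open>After scaling \<open>u\<close> down, at most \<open>card E + 1\<close> weights may be
  taken fractional. If no weight were 0, all the others would be 1 and the total would exceed
  \<open>card A - card E - 1\<close>.\<close>

lemma exists_weights_with_zero:
  fixes x :: "'i \<Rightarrow> 'e \<Rightarrow> real"
  assumes "finite A" "finite E" "card E < card A"
    and "\<forall>i\<in>A. 0 \<le> u i \<and> u i \<le> 1" and "\<forall>e\<in>E. (\<Sum>i\<in>A. u i * x i e) = 0"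
    and "sum u A = real (card A) - real (card E)"
  shows "\<exists>w. \<exists>j\<in>A. w j = 0 \<and> (\<forall>i\<in>A. 0 \<le> w i \<and> w i \<le> 1) \<and>
    (\<forall>e\<in>E. (\<Sum>i\<in>A. w i * x i e) = 0) \<and> sum w A = real (card A) - real (card E) - 1"
proof -
  define k d where "k = real (card A)" and "d = real (card E)"
  have kd: "k - d \<ge> 1" using assms(3) by (simp add: k_def d_def)
  \<comment> \<open>This factor lowers the total weight from \<open>k - d\<close> to
    \<open>k - d - 1\<close>.\<close>
  define q where "q = (k - d - 1) / (k - d)"
  have q: "0 \<le> q" "q \<le> 1" using kd by (auto simp: q_def divide_simps)
  have qs: "(\<Sum>i\<in>A. q * u i * x i e) = q * (\<Sum>i\<in>A. u i * x i e)" for e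
    by (simp add: sum_distrib_left mult.assoc)
  have "(\<Sum>i\<in>A. q * u i) = q * sum u A" by (simp add: sum_distrib_left)
  then have qsum: "(\<Sum>i\<in>A. q * u i) = k - d - 1"
    using kd assms(6) by (simp add: q_def k_def d_def)
  have "\<forall>i\<in>A. 0 \<le> q * u i \<and> q * u i \<le> 1"
    using q assms(4) by (auto intro: mult_le_one)
  then obtain w where w: "\<forall>i\<in>A. 0 \<le> w i \<and> w i \<le> 1" "\<forall>e\<in>E. (\<Sum>i\<in>A. w i * x i e) = 0"
      "sum w A = k - d - 1" "card {i\<in>A. 0 < w i \<and> w i < 1} \<le> Suc (card E)"
    using exists_weights_few_fractional[OF assms(1,2), of "\<lambda>i. q * u i" x] assms(5) qs qsum
    by auto
  have "\<exists>j\<in>A. w j = 0"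
  proof (rule ccontr)
    assume neg: "\<not> ?thesis"
    define I where "I = {i\<in>A. 0 < w i \<and> w i < 1}"
    have pos: "0 < w i" if "i \<in> A" for i using neg w(1) that by (metis order_le_less)
    have I: "I \<subseteq> A" "finite I" using assms(1) by (auto simp: I_def)
    have "sum w A = sum w (A - I) + sum w I"
      using assms(1) I by (simp add: sum.subset_diff)
    also have "sum w (A - I) = (\<Sum>i\<in>A - I. 1)"
      by (intro sum.cong) (use pos w(1) in \<open>force simp: I_def\<close>)+
    also have "\<dots> = k - real (card I)"
      using I assms(1) by (simp add: card_Diff_subset k_def card_mono of_nat_diff)
    finally have eq: "k - d - 1 = k - real (card I) + sum w I" using w(3) by simp
    show False
    proof (cases "I = {}")
      case True
      then show False using eq d_def by simp
    next
      case False
      then have "sum w I > 0" using I pos by (intro sum_pos) auto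
      moreover have "real (card I) \<le> d + 1" using w(4) unfolding I_def d_def by simp
      ultimately show False using eq by simp
    qed
  qed
  then show ?thesis using w unfolding k_def d_def by blast
qed

lemma abs_sum_le_card:
  fixes x :: "'i \<Rightarrow> real"
  assumes "\<forall>i\<in>A. \<bar>x i\<bar> \<le> M"
  shows "\<bar>sum x A\<bar> \<le> real (card A) * M"
  using order_trans[OF sum_abs sum_bounded_above] assms by metis

text \<open>The proof of Grinberg and Sevastyanov: the weights certify the bound for all of \<open>A\<close>, and an
  index of weight \<open>0\<close> can be placed last.\<close>

lemma steinitz_weighted:
  fixes x :: "'i \<Rightarrow> 'e \<Rightarrow> real"
  assumes "finite A" "finite E" "0 \<le> M" "\<forall>i\<in>A. \<forall>e\<in>E. \<bar>x i e\<bar> \<le> M"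
    and "card E < card A \<Longrightarrow> \<exists>u. (\<forall>i\<in>A. 0 \<le> u i \<and> u i \<le> 1) \<and>
      (\<forall>e\<in>E. (\<Sum>i\<in>A. u i * x i e) = 0) \<and> sum u A = real (card A) - real (card E)"
  shows "\<exists>xs. distinct xs \<and> set xs = A \<and>
    (\<forall>k\<le>length xs. \<forall>e\<in>E. \<bar>\<Sum>i\<in>set (take k xs). x i e\<bar> \<le> real (card E) * M)"
  using assms(1,4,5)
proof (induction "card A" arbitrary: A rule: less_induct)
  case less
  show ?case
  proof (cases "card A \<le> card E")
    case True
    \<comment> \<open>With at most \<open>card E\<close> vectors any order will do, since no partial
      sum has more than \<open>card E\<close> terms.\<close>
    obtain xs where xs: "distinct xs" "set xs = A"
      using less.prems(1) finite_distinct_list by auto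
    have "\<bar>\<Sum>i\<in>set (take k xs). x i e\<bar> \<le> real (card E) * M" if "e \<in> E" for k e
    proof -
      have "\<bar>\<Sum>i\<in>set (take k xs). x i e\<bar> \<le> real (card (set (take k xs))) * M"
        using less.prems(2) xs that by (intro abs_sum_le_card) (auto dest: in_set_takeD)
      also have "card (set (take k xs)) \<le> card E"
        using True xs less.prems(1) card_mono[of A "set (take k xs)"] set_take_subset[of k xs]
        by auto
      finally show ?thesis using assms(3) by (simp add: mult_right_mono)
    qed
    then show ?thesis using xs by blast
  next
    case False
    then obtain u where u: "\<forall>i\<in>A. 0 \<le> u i \<and> u i \<le> 1" "\<forall>e\<in>E. (\<Sum>i\<in>A. u i * x i e) = 0"
        "sum u A = real (card A) - real (card E)"
      using less.prems(3) by auto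
    then obtain w j where j: "j \<in> A" "w j = 0" and w: "\<forall>i\<in>A. 0 \<le> w i \<and> w i \<le> 1"
        "\<forall>e\<in>E. (\<Sum>i\<in>A. w i * x i e) = 0" "sum w A = real (card A) - real (card E) - 1"
      using exists_weights_with_zero[OF less.prems(1) assms(2), of u x] False by auto
    define B where "B = A - {j}"
    have B: "A = insert j B" "j \<notin> B" "finite B" "card A = Suc (card B)"
      using j less.prems(1) by (auto simp: B_def simp del: card_Diff_insert intro: card.remove)
    \<comment> \<open>Dropping \<open>j\<close> changes neither the total nor the weighted sums of
      \<open>w\<close>, and \<open>card A - 1 = card B\<close>, so \<open>w\<close> certifies
      \<open>B\<close>.\<close>
    have "\<exists>u. (\<forall>i\<in>B. 0 \<le> u i \<and> u i \<le> 1) \<and> (\<forall>e\<in>E. (\<Sum>i\<in>B. u i * x i e) = 0) \<and>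
        sum u B = real (card B) - real (card E)"
      using w j B by (intro exI[of _ w]) auto
    then obtain xs where xs: "distinct xs" "set xs = B"
        "\<forall>k\<le>length xs. \<forall>e\<in>E. \<bar>\<Sum>i\<in>set (take k xs). x i e\<bar> \<le> real (card E) * M"
      using less.hyps[of B] B less.prems(2) by auto
    have full: "\<bar>\<Sum>i\<in>A. x i e\<bar> \<le> real (card E) * M" if "e \<in> E" for e
    proof -
      \<comment> \<open>The sum weighted by \<open>u\<close> vanishes, so it may be subtracted; the
        remaining weights \<open>1 - u i\<close> are nonnegative and have total
        \<open>card E\<close>.\<close>
      have "(\<Sum>i\<in>A. x i e) = (\<Sum>i\<in>A. (1 - u i) * x i e)"
        using u(2) that by (simp add: algebra_simps sum_subtractf)
      also have "\<bar>\<dots>\<bar> \<le> (\<Sum>i\<in>A. \<bar>(1 - u i) * x i e\<bar>)" by (rule sum_abs)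
      also have "\<dots> \<le> (\<Sum>i\<in>A. (1 - u i) * M)"
        using u(1) less.prems(2) that by (intro sum_mono) (auto simp: abs_mult intro: mult_left_mono)
      also have "\<dots> = (real (card A) - sum u A) * M"
        by (simp add: sum_distrib_right[symmetric] sum_subtractf)
      finally show ?thesis using u(3) by simp
    qed
    show ?thesis
    proof (intro exI[of _ "xs @ [j]"] conjI allI impI ballI)
      fix k e assume k: "k \<le> length (xs @ [j])" and e: "e \<in> E"
      show "\<bar>\<Sum>i\<in>set (take k (xs @ [j])). x i e\<bar> \<le> real (card E) * M"
      proof (cases "k \<le> length xs")
        case True then show ?thesis using xs(3) e by auto
      next
        case False
        then have "set (take k (xs @ [j])) = A" using k xs(2) B by auto
        then show ?thesis using full[OF e] by simp
      qed
    qed (use xs B in auto)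
  qed
qed

theorem steinitz:
  fixes x :: "'i \<Rightarrow> 'e \<Rightarrow> real"
  assumes "finite A" "finite E" "0 \<le> M" "\<forall>i\<in>A. \<forall>e\<in>E. \<bar>x i e\<bar> \<le> M"
    and "\<forall>e\<in>E. (\<Sum>i\<in>A. x i e) = 0"
  shows "\<exists>xs. distinct xs \<and> set xs = A \<and>
    (\<forall>k\<le>length xs. \<forall>e\<in>E. \<bar>\<Sum>i\<in>set (take k xs). x i e\<bar> \<le> real (card E) * M)"
proof (rule steinitz_weighted[OF assms(1-4)])
  assume lt: "card E < card A"
  \<comment> \<open>A constant weight with total \<open>card A - card E\<close> is admissible at the
    start because the unweighted sums are 0.\<close>
  define q where "q = (real (card A) - real (card E)) / real (card A)"
  have "0 \<le> q" "q \<le> 1" "real (card A) * q = real (card A) - real (card E)"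
    using lt by (auto simp: q_def divide_simps)
  moreover have "(\<Sum>i\<in>A. q * x i e) = 0" if "e \<in> E" for e
    using assms(5) that by (simp add: sum_distrib_left[symmetric])
  ultimately show "\<exists>u. (\<forall>i\<in>A. 0 \<le> u i \<and> u i \<le> 1) \<and>
      (\<forall>e\<in>E. (\<Sum>i\<in>A. u i * x i e) = 0) \<and> sum u A = real (card A) - real (card E)"
    by (intro exI[of _ "\<lambda>_. q"]) auto
qed

section \<open>Graver bases of row sets\<close>

text \<open>Vectors are functions vanishing outside \<open>C\<close>, so equality of vectors is
  equality of functions. Rows keep their names when passing to a subset \<open>R\<close>, which
  avoids reindexing submatrices.\<close>

definition row_kernel :: "('r \<Rightarrow> 'c \<Rightarrow> int) \<Rightarrow> 'c set \<Rightarrow> 'r set \<Rightarrow> ('c \<Rightarrow> int) set" where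
  "row_kernel a C R = {x. (\<forall>c. c \<notin> C \<longrightarrow> x c = 0) \<and> (\<forall>r\<in>R. (\<Sum>c\<in>C. a r c * x c) = 0)}"

text \<open>The order of \<open>conformal_le\<close> in a form without products or absolute values,
  suited to linear arithmetic.\<close>

definition conformal :: "('c \<Rightarrow> int) \<Rightarrow> ('c \<Rightarrow> int) \<Rightarrow> bool" where
  "conformal h x \<longleftrightarrow> (\<forall>c. (0 \<le> h c \<and> h c \<le> x c) \<or> (x c \<le> h c \<and> h c \<le> 0))"

definition graver :: "('r \<Rightarrow> 'c \<Rightarrow> int) \<Rightarrow> 'c set \<Rightarrow> 'r set \<Rightarrow> ('c \<Rightarrow> int) set" where
  "graver a C R = {x \<in> row_kernel a C R. x \<noteq> (\<lambda>_. 0) \<and>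
     (\<forall>h\<in>row_kernel a C R. h \<noteq> (\<lambda>_. 0) \<longrightarrow> conformal h x \<longrightarrow> h = x)}"

definition l1 :: "'c set \<Rightarrow> ('c \<Rightarrow> int) \<Rightarrow> int" where
  "l1 C x = (\<Sum>c\<in>C. \<bar>x c\<bar>)"

section \<open>Conformal order, kernels and conformal sums\<close>

lemma conformal_refl: "conformal x x"
  by (auto simp: conformal_def)

lemma conformal_trans: "conformal x y \<Longrightarrow> conformal y z \<Longrightarrow> conformal x z"
  unfolding conformal_def by (smt (verit))

lemma conformal_diff: "conformal h x \<Longrightarrow> conformal (\<lambda>c. x c - h c) x"
  unfolding conformal_def by (smt (verit))

lemma conformal_l1_less:
  assumes "finite C" "conformal h x" "\<exists>c\<in>C. h c \<noteq> x c"
  shows "l1 C h < l1 C x"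
  unfolding l1_def
proof (rule sum_strict_mono_ex1)
  show "\<forall>c\<in>C. \<bar>h c\<bar> \<le> \<bar>x c\<bar>" using assms(2) unfolding conformal_def by (smt (verit))
  show "\<exists>c\<in>C. \<bar>h c\<bar> < \<bar>x c\<bar>" using assms(2,3) unfolding conformal_def by (smt (verit))
qed fact

lemma row_kernel_support: "x \<in> row_kernel a C R \<Longrightarrow> x \<noteq> y \<Longrightarrow> y \<in> row_kernel a C R' \<Longrightarrow> \<exists>c\<in>C. x c \<noteq> y c"
  unfolding row_kernel_def by fastforce

lemma zero_in_row_kernel: "(\<lambda>_. 0) \<in> row_kernel a C R"
  by (simp add: row_kernel_def)

lemma row_kernel_diff:
  "x \<in> row_kernel a C R \<Longrightarrow> y \<in> row_kernel a C R \<Longrightarrow> (\<lambda>c. x c - y c) \<in> row_kernel a C R"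
  by (simp add: row_kernel_def right_diff_distrib sum_subtractf)

lemma row_kernel_Un: "row_kernel a C (R \<union> S) = row_kernel a C R \<inter> row_kernel a C S"
  by (auto simp: row_kernel_def)

lemma row_kernel_sum:
  assumes "\<forall>i\<in>I. g i \<in> row_kernel a C R"
  shows "(\<lambda>c. \<Sum>i\<in>I. g i c) \<in> row_kernel a C R"
proof -
  have "(\<Sum>c\<in>C. a r c * (\<Sum>i\<in>I. g i c)) = (\<Sum>i\<in>I. \<Sum>c\<in>C. a r c * g i c)" for r
    by (simp add: sum_distrib_left sum.swap[of _ C])
  then show ?thesis using assms by (simp add: row_kernel_def)
qed

lemma l1_nonneg: "0 \<le> l1 C x"
  by (simp add: l1_def sum_nonneg)

lemma l1_pos: "finite C \<Longrightarrow> g \<in> graver a C R \<Longrightarrow> 1 \<le> l1 C g"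
proof -
  assume C: "finite C" and g: "g \<in> graver a C R"
  have "\<exists>c\<in>C. g c \<noteq> 0"
    using g row_kernel_support[OF _ _ zero_in_row_kernel] by (auto simp: graver_def)
  then have "0 < l1 C g" unfolding l1_def using C by (meson sum_pos2 abs_ge_zero zero_less_abs_iff)
  then show ?thesis by simp
qed

text \<open>Descent on the norm: if \<open>x\<close> is not minimal, some nonzero kernel element
  lies strictly below it and has a smaller norm.\<close>

lemma exists_conformal_graver:
  assumes "finite C" "x \<in> row_kernel a C R" "x \<noteq> (\<lambda>_. 0)"
  shows "\<exists>g\<in>graver a C R. conformal g x"
  using assms(2,3)
proof (induction "nat (l1 C x)" arbitrary: x rule: less_induct)
  case less
  show ?case
  proof (cases "x \<in> graver a C R")
    case True then show ?thesis using conformal_refl by blast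
  next
    case False
    then obtain h where h: "h \<in> row_kernel a C R" "h \<noteq> (\<lambda>_. 0)" "conformal h x" "h \<noteq> x"
      using less.prems unfolding graver_def by auto
    then have "l1 C h < l1 C x"
      using conformal_l1_less[OF assms(1)] row_kernel_support less.prems(1) by blast
    then have "nat (l1 C h) < nat (l1 C x)" using l1_nonneg[of C h] by linarith
    then show ?thesis using less.hyps[OF _ h(1,2)] h(3) conformal_trans by blast
  qed
qed

text \<open>Peel off a Graver element \<open>h\<close> below \<open>x\<close>. The rest
  \<open>x - h\<close> stays in the kernel, is conformal to \<open>x\<close> and has a smaller norm,
  so its summands are again conformal to \<open>x\<close>.\<close>

lemma conformal_decomposition:
  assumes "finite C" "x \<in> row_kernel a C R"
  shows "\<exists>N g. (\<forall>i<N. g i \<in> graver a C R \<and> conformal (g i) x) \<and> (\<forall>c. x c = (\<Sum>i<(N::nat). g i c))"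
  using assms(2)
proof (induction "nat (l1 C x)" arbitrary: x rule: less_induct)
  case less
  show ?case
  proof (cases "x = (\<lambda>_. 0)")
    case True then show ?thesis by (intro exI[of _ 0]) auto
  next
    case False
    then obtain h where h: "h \<in> graver a C R" "conformal h x"
      using exists_conformal_graver assms(1) less.prems by blast
    define y where "y = (\<lambda>c. x c - h c)"
    have y: "y \<in> row_kernel a C R" "conformal y x"
      unfolding y_def using h less.prems by (auto intro: row_kernel_diff conformal_diff simp: graver_def)
    have "\<exists>c\<in>C. h c \<noteq> 0"
      using h row_kernel_support[OF _ _ zero_in_row_kernel] by (auto simp: graver_def)
    then have "l1 C y < l1 C x"
      using conformal_l1_less[OF assms(1) y(2)] by (auto simp: y_def)
    then have "nat (l1 C y) < nat (l1 C x)" using l1_nonneg[of C y] by linarith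
    then obtain N g where g: "\<forall>i<N. g i \<in> graver a C R \<and> conformal (g i) y"
        "\<forall>c. y c = (\<Sum>i<(N::nat). g i c)"
      using less.hyps[OF _ y(1)] by blast
    have "x c = (\<Sum>i<Suc N. (g(N := h)) i c)" for c
    proof -
      have "(\<Sum>i<N. (g(N := h)) i c) = y c" using g(2) by (auto intro!: sum.cong)
      then show ?thesis by (simp add: y_def)
    qed
    moreover have "\<forall>i<Suc N. (g(N := h)) i \<in> graver a C R \<and> conformal ((g(N := h)) i) x"
      using g(1) h conformal_trans[OF _ y(2)] by (auto simp: less_Suc_eq)
    ultimately show ?thesis by blast
  qed
qed

text \<open>In each coordinate all summands carry the sign of \<open>x\<close>, so nothing cancels.
  This makes the norm additive on conformal sums.\<close>

lemma conformal_abs_sum: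
  assumes "\<forall>i\<in>I. conformal (g i) x"
  shows "\<bar>\<Sum>i\<in>I. g i c\<bar> = (\<Sum>i\<in>I. \<bar>g i c\<bar>)"
proof (cases "x c \<ge> 0")
  case True
  then have "\<forall>i\<in>I. g i c \<ge> 0" using assms unfolding conformal_def by (smt (verit))
  then show ?thesis by (simp add: sum_nonneg)
next
  case False
  then have neg: "\<forall>i\<in>I. g i c \<le> 0" using assms unfolding conformal_def by (smt (verit))
  then have "(\<Sum>i\<in>I. \<bar>g i c\<bar>) = - (\<Sum>i\<in>I. g i c)" by (simp add: sum_negf[symmetric])
  then show ?thesis using neg by (simp add: sum_nonpos)
qed

lemma l1_sum_conformal:
  assumes "\<forall>i\<in>I. conformal (g i) x"
  shows "l1 C (\<lambda>c. \<Sum>i\<in>I. g i c) = (\<Sum>i\<in>I. l1 C (g i))"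
  unfolding l1_def conformal_abs_sum[OF assms] by (rule sum.swap)

text \<open>Allows a partial selection of the summands of \<open>x\<close> to be compared with
  \<open>x\<close> by minimality.\<close>

lemma conformal_subsum:
  assumes "finite J" "I \<subseteq> J" "\<forall>i\<in>J. conformal (g i) x" "\<forall>c. x c = (\<Sum>i\<in>J. g i c)"
  shows "conformal (\<lambda>c. \<Sum>i\<in>I. g i c) x"
  unfolding conformal_def
proof
  fix c
  show "(0 \<le> (\<Sum>i\<in>I. g i c) \<and> (\<Sum>i\<in>I. g i c) \<le> x c) \<or> (x c \<le> (\<Sum>i\<in>I. g i c) \<and> (\<Sum>i\<in>I. g i c) \<le> 0)"
  proof (cases "x c \<ge> 0")
    case True
    then have "\<forall>i\<in>J. g i c \<ge> 0" using assms unfolding conformal_def by (smt (verit))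
    then show ?thesis using assms by (auto intro!: sum_nonneg sum_mono2)
  next
    case False
    then have neg: "\<forall>i\<in>J. g i c \<le> 0" using assms unfolding conformal_def by (smt (verit))
    then have "(\<Sum>i\<in>I. - g i c) \<le> (\<Sum>i\<in>J. - g i c)"
      using assms(1,2) by (intro sum_mono2) auto
    then have "x c \<le> (\<Sum>i\<in>I. g i c)" using assms(4) by (simp add: sum_negf)
    moreover have "(\<Sum>i\<in>I. g i c) \<le> 0" using neg assms(2) by (auto intro: sum_nonpos)
    ultimately show ?thesis by simp
  qed
qed

section \<open>Norm bounds for Graver elements: adding rows and splitting into blocks\<close>

lemma abs_row_le_l1:
  assumes "\<forall>c\<in>C. \<bar>b c\<bar> \<le> D"
  shows "\<bar>\<Sum>c\<in>C. b c * g c\<bar> \<le> D * l1 C g"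
proof -
  have "\<bar>\<Sum>c\<in>C. b c * g c\<bar> \<le> (\<Sum>c\<in>C. \<bar>b c * g c\<bar>)" by (rule sum_abs)
  also have "\<dots> \<le> (\<Sum>c\<in>C. D * \<bar>g c\<bar>)"
    using assms by (intro sum_mono) (auto simp: abs_mult intro: mult_right_mono)
  finally show ?thesis by (simp add: l1_def sum_distrib_left)
qed

text \<open>In the bound, \<open>B\<close> accounts for the norm of one summand and the power for
  the number of summands.\<close>

lemma graver_bound_add_rows:
  assumes fin: "finite C" "finite T" and "0 \<le> D" "0 \<le> B"
    and D: "\<forall>r\<in>T. \<forall>c\<in>C. \<bar>a r c\<bar> \<le> D"
    and B: "\<forall>g\<in>graver a C S. l1 C g \<le> B"
    and x: "x \<in> graver a C (S \<union> T)"
  shows "l1 C x \<le> B * (2 * int (card T) * D * B + 1) ^ card T"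
proof -
  have xk: "x \<in> row_kernel a C S" "x \<in> row_kernel a C T"
    using x by (auto simp: graver_def row_kernel_Un)
  obtain N g where g: "\<forall>i<N. g i \<in> graver a C S \<and> conformal (g i) x"
      and xsum: "\<forall>c. x c = (\<Sum>i<(N::nat). g i c)"
    using conformal_decomposition[OF fin(1) xk(1)] by blast
  \<comment> \<open>\<open>y i\<close> is the image of the summand \<open>g i\<close> under the
    added rows; these images are what Steinitz' lemma orders.\<close>
  define y where "y = (\<lambda>i r. \<Sum>c\<in>C. a r c * g i c)"
  have y_le: "\<bar>y i r\<bar> \<le> D * B" if "i < N" "r \<in> T" for i r
  proof -
    have "\<bar>y i r\<bar> \<le> D * l1 C (g i)" unfolding y_def using D that by (intro abs_row_le_l1) auto
    also have "\<dots> \<le> D * B" using g B that \<open>0 \<le> D\<close> by (intro mult_left_mono) auto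
    finally show ?thesis .
  qed
  have y_sum: "(\<Sum>i\<in>I. y i r) = (\<Sum>c\<in>C. a r c * (\<Sum>i\<in>I. g i c))" for I r
    by (simp add: y_def sum_distrib_left sum.swap[of _ C])
  have y0: "(\<Sum>i<N. y i r) = 0" if "r \<in> T" for r
    using xk(2) that xsum by (simp add: y_sum row_kernel_def)
  define M where "M = int (card T) * (D * B)"
  obtain xs where xs: "distinct xs" "set xs = {..<N}"
    and pre: "\<And>k r. k \<le> N \<Longrightarrow> r \<in> T \<Longrightarrow> \<bar>\<Sum>i\<in>set (take k xs). y i r\<bar> \<le> M"
  proof -
    \<comment> \<open>Steinitz' lemma works over the reals, so the integer images are cast there and
      the bound is cast back afterwards.\<close>
    have "\<exists>xs. distinct xs \<and> set xs = {..<N} \<and> (\<forall>k\<le>length xs. \<forall>r\<in>T.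
        \<bar>\<Sum>i\<in>set (take k xs). real_of_int (y i r)\<bar> \<le> real (card T) * real_of_int (D * B))"
    proof (rule steinitz)
      show "\<forall>i\<in>{..<N}. \<forall>r\<in>T. \<bar>real_of_int (y i r)\<bar> \<le> real_of_int (D * B)"
        using y_le by (metis lessThan_iff of_int_abs of_int_le_iff)
      show "\<forall>r\<in>T. (\<Sum>i<N. real_of_int (y i r)) = 0"
        using y0 by (simp flip: of_int_sum)
      show "0 \<le> real_of_int (D * B)" using \<open>0 \<le> D\<close> \<open>0 \<le> B\<close> by simp
    qed (use fin in auto)
    then obtain xs where xs: "distinct xs" "set xs = {..<N}" and
      p: "\<forall>k\<le>length xs. \<forall>r\<in>T.
        \<bar>\<Sum>i\<in>set (take k xs). real_of_int (y i r)\<bar> \<le> real (card T) * real_of_int (D * B)"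
      by blast
    have "length xs = N" using xs distinct_card[of xs] by simp
    moreover have "real_of_int \<bar>\<Sum>i\<in>set (take k xs). y i r\<bar> \<le> real_of_int M"
      if "k \<le> length xs" "r \<in> T" for k r
      using p that by (simp add: M_def)
    ultimately show ?thesis using that xs by (metis of_int_le_iff)
  qed
  have len: "length xs = N" using xs distinct_card[of xs] by simp
  \<comment> \<open>The \<open>k\<close>-th partial sum, restricted to \<open>T\<close> so that it
    lies in a finite product of intervals. Only \<open>k < N\<close> is considered: the full sum is
    0 and would repeat the empty one.\<close>
  define p where "p = (\<lambda>k. \<lambda>r\<in>T. \<Sum>i\<in>set (take k xs). y i r)"
  have "inj_on p {..<N}"
  proof (rule linorder_inj_onI)
    fix k l assume kl: "k < l" "k \<in> {..<N}" "l \<in> {..<N}"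
    show "p k \<noteq> p l"
    proof
      assume eq: "p k = p l"
      \<comment> \<open>If two partial sums agree, the images indexed by \<open>I\<close> add up to
        0. Now \<open>I\<close> is nonempty by \<open>k < l\<close> and proper by
        \<open>l < N\<close>, so the summands in \<open>I\<close> give a nonzero kernel element
        strictly below \<open>x\<close>, against minimality.\<close>
      define I where "I = set (take l xs) - set (take k xs)"
      have sub: "set (take k xs) \<subseteq> set (take l xs)" using kl by (simp add: set_take_subset_set_take)
      have cards: "card (set (take k xs)) = k" "card (set (take l xs)) = l"
        using kl len xs(1) by (auto simp: distinct_card)
      then have "I \<noteq> {}" using sub kl unfolding I_def by auto
      have I: "I \<subseteq> {..<N}" "finite I" unfolding I_def using xs(2) by (auto dest: in_set_takeD)
      have "card I \<le> l" unfolding I_def using cards(2) by (metis Diff_subset List.finite_set card_mono)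
      then have "I \<noteq> {..<N}" using kl by auto
      have "(\<Sum>i\<in>I. y i r) = 0" if "r \<in> T" for r
      proof -
        have "(\<Sum>i\<in>set (take k xs). y i r) = (\<Sum>i\<in>set (take l xs). y i r)"
          using fun_cong[OF eq, of r] that by (simp add: p_def)
        then show ?thesis unfolding I_def using sub by (simp add: sum_diff)
      qed
      moreover define h where "h = (\<lambda>c. \<Sum>i\<in>I. g i c)"
      have hS: "h \<in> row_kernel a C S"
        unfolding h_def using g I by (intro row_kernel_sum) (auto simp: graver_def)
      ultimately have "h \<in> row_kernel a C (S \<union> T)"
        by (auto simp: h_def row_kernel_def y_sum)
      moreover have "conformal h x"
        unfolding h_def using g I xsum by (intro conformal_subsum[of "{..<N}"]) auto
      moreover have lh: "l1 C h = (\<Sum>i\<in>I. l1 C (g i))"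
        unfolding h_def using g I by (intro l1_sum_conformal[of _ _ x]) auto
      moreover have pos: "1 \<le> l1 C (g i)" if "i < N" for i using l1_pos[OF fin(1)] g that by blast
      moreover have "0 < l1 C h"
        unfolding lh using I \<open>I \<noteq> {}\<close> pos by (intro sum_pos) force+
      then have "h \<noteq> (\<lambda>_. 0)" by (auto simp: l1_def)
      ultimately have "h = x" using x unfolding graver_def by blast
      moreover have "l1 C x = (\<Sum>i<N. l1 C (g i))"
        using l1_sum_conformal[of "{..<N}" g x C] g xsum by (simp flip: fun_eq_iff)
      moreover have "(\<Sum>i\<in>I. l1 C (g i)) < (\<Sum>i<N. l1 C (g i))"
      proof -
        obtain j where "j < N" "j \<notin> I" using I \<open>I \<noteq> {..<N}\<close> by blast
        then show ?thesis using I pos by (intro sum_strict_mono2[of _ _ j]) force+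
      qed
      ultimately show False using lh by simp
    qed
  qed auto
  moreover have "p ` {..<N} \<subseteq> (\<Pi>\<^sub>E r\<in>T. {-M..M})"
  proof (intro subsetI, elim imageE)
    fix q k assume "k \<in> {..<N}" "q = p k"
    moreover have "(\<Sum>i\<in>set (take k xs). y i r) \<in> {-M..M}" if "k < N" "r \<in> T" for k r
      using pre[of k r] that by (simp add: abs_le_iff)
    ultimately show "q \<in> (\<Pi>\<^sub>E r\<in>T. {-M..M})"
      by (simp add: p_def PiE_def Pi_def)
  qed
  moreover have "finite (\<Pi>\<^sub>E r\<in>T. {-M..M})" using fin(2) by (intro finite_PiE) auto
  ultimately have "card {..<N} \<le> card (\<Pi>\<^sub>E r\<in>T. {-M..M})"
    using card_inj_on_le by blast
  then have "N \<le> nat (2 * M + 1) ^ card T"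
    using fin(2) by (simp add: card_PiE)
  then have "int N \<le> int (nat (2 * M + 1) ^ card T)" by (simp only: of_nat_le_iff)
  moreover have "0 \<le> M" using \<open>0 \<le> D\<close> \<open>0 \<le> B\<close> by (simp add: M_def)
  ultimately have N: "int N \<le> (2 * M + 1) ^ card T" by simp
  have "l1 C x = (\<Sum>i<N. l1 C (g i))"
    using l1_sum_conformal[of "{..<N}" g x C] g xsum by (simp flip: fun_eq_iff)
  also have "\<dots> \<le> (\<Sum>i<N. B)" using g B by (intro sum_mono) auto
  also have "\<dots> = B * int N" by simp
  also have "\<dots> \<le> B * (2 * M + 1) ^ card T" using N \<open>0 \<le> B\<close> by (rule mult_left_mono)
  finally show ?thesis by (simp add: M_def mult.assoc)
qed

text \<open>If some block meets the support of \<open>x\<close>, restricting \<open>x\<close> to the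
  columns of that block gives a kernel element of all blocks, and minimality makes it equal to
  \<open>x\<close>. Otherwise every row vanishes on the support and \<open>x\<close> is a signed
  unit vector, which is where \<open>1 \<le> B\<close> enters. An empty \<open>I\<close>, as below a
  leaf, falls into the second case.\<close>

lemma graver_bound_blocks:
  assumes "finite C" and disj: "\<And>i j r s c. i \<in> I \<Longrightarrow> j \<in> I \<Longrightarrow> i \<noteq> j \<Longrightarrow> r \<in> R i \<Longrightarrow> s \<in> R j \<Longrightarrow>
      c \<in> C \<Longrightarrow> a r c = 0 \<or> a s c = 0"
    and B: "\<And>i g. i \<in> I \<Longrightarrow> g \<in> graver a C (R i) \<Longrightarrow> l1 C g \<le> B" and "1 \<le> B"
    and x: "x \<in> graver a C (\<Union>i\<in>I. R i)"
  shows "l1 C x \<le> B"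
proof (cases "\<exists>i\<in>I. \<exists>r\<in>R i. \<exists>c\<in>C. a r c \<noteq> 0 \<and> x c \<noteq> 0")
  case True
  then obtain i r0 c0 where i: "i \<in> I" "r0 \<in> R i" "c0 \<in> C" "a r0 c0 \<noteq> 0" "x c0 \<noteq> 0" by blast
  \<comment> \<open>A vector supported on the columns of block \<open>i\<close> is annihilated by
    every other block, since those columns are zero there.\<close>
  have lift: "y \<in> row_kernel a C (\<Union>i\<in>I. R i)"
    if "y \<in> row_kernel a C (R i)" "\<forall>c. y c \<noteq> 0 \<longrightarrow> (\<exists>r\<in>R i. a r c \<noteq> 0)" for y
    unfolding row_kernel_def
  proof (intro CollectI conjI ballI)
    fix s assume "s \<in> (\<Union>i\<in>I. R i)"
    then obtain j where j: "j \<in> I" "s \<in> R j" by blast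
    show "(\<Sum>c\<in>C. a s c * y c) = 0"
    proof (cases "j = i")
      case True then show ?thesis using that(1) j by (simp add: row_kernel_def)
    next
      case False
      then have "a s c * y c = 0" if "c \<in> C" for c
        using disj[OF i(1) j(1) _ _ j(2) that] \<open>\<forall>c. y c \<noteq> 0 \<longrightarrow> _\<close> by fastforce
      then show ?thesis by simp
    qed
  qed (use that in \<open>simp add: row_kernel_def\<close>)
  define h where "h = (\<lambda>c. if \<exists>r\<in>R i. a r c \<noteq> 0 then x c else 0)"
  have xi: "x \<in> row_kernel a C (R i)" using x i(1) by (auto simp: graver_def row_kernel_def)
  have "(\<Sum>c\<in>C. a r c * h c) = (\<Sum>c\<in>C. a r c * x c)" if "r \<in> R i" for r
    using that by (intro sum.cong) (auto simp: h_def)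
  then have "h \<in> row_kernel a C (R i)" using xi by (auto simp: row_kernel_def h_def)
  then have "h \<in> row_kernel a C (\<Union>i\<in>I. R i)" by (rule lift) (auto simp: h_def)
  moreover have "conformal h x" by (auto simp: h_def conformal_def)
  moreover have "h c0 \<noteq> 0" using i by (auto simp: h_def)
  then have "h \<noteq> (\<lambda>_. 0)" by auto
  ultimately have "h = x" using x by (auto simp: graver_def)
  have "x \<in> graver a C (R i)"
    unfolding graver_def
  proof (intro CollectI conjI ballI impI)
    fix y assume y: "y \<in> row_kernel a C (R i)" "y \<noteq> (\<lambda>_. 0)" "conformal y x"
    have "\<exists>r\<in>R i. a r c \<noteq> 0" if "y c \<noteq> 0" for c
    proof -
      have "x c \<noteq> 0" using y(3) that unfolding conformal_def by (smt (verit))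
      then have "h c \<noteq> 0" using \<open>h = x\<close> by simp
      then show ?thesis by (auto simp: h_def split: if_splits)
    qed
    then have "y \<in> row_kernel a C (\<Union>i\<in>I. R i)" using lift y(1) by blast
    then show "y = x" using x y by (auto simp: graver_def)
  qed (use xi x in \<open>auto simp: graver_def\<close>)
  then show ?thesis using B i(1) by blast
next
  case False
  obtain c0 where c0: "c0 \<in> C" "x c0 \<noteq> 0"
    using x row_kernel_support[OF _ _ zero_in_row_kernel] by (force simp: graver_def)
  \<comment> \<open>No row sees column \<open>c0\<close>, so the unit vector with the sign of
    \<open>x c0\<close> is in the kernel and below \<open>x\<close>.\<close>
  define h where "h = (\<lambda>c. if c = c0 then sgn (x c0) else 0)"
  have "a r c * h c = 0" if "r \<in> (\<Union>i\<in>I. R i)" "c \<in> C" for r c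
    using False that c0 by (auto simp: h_def)
  then have "h \<in> row_kernel a C (\<Union>i\<in>I. R i)"
    using c0 by (auto simp: row_kernel_def h_def simp del: mult_eq_0_iff intro!: sum.neutral)
  moreover have "conformal h x" by (auto simp: h_def conformal_def sgn_if)
  moreover have "h c0 \<noteq> 0" using c0 by (simp add: h_def sgn_if)
  then have "h \<noteq> (\<lambda>_. 0)" by auto
  ultimately have "h = x" using x by (auto simp: graver_def)
  moreover have "l1 C h = (\<Sum>c\<in>C. if c = c0 then 1 else 0)"
    unfolding l1_def using c0 by (intro sum.cong) (auto simp: h_def sgn_if)
  ultimately show ?thesis using assms(1,4) c0 by simp
qed

section \<open>Rooted trees and path weights\<close>

text \<open>Here \<open>j\<close> counts the degenerate vertices passed since the last non-degenerate one.\<close>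

fun path_weight :: "('v \<Rightarrow> bool) \<Rightarrow> nat \<Rightarrow> 'v list \<Rightarrow> nat" where
  "path_weight d j [] = 1"
| "path_weight d j (v # P) = (if d v then path_weight d (Suc j) P else (j + 2) * path_weight d 0 P)"

text \<open>For the positions following \<open>b(1)\<close> this is the product of the factors
  \<open>k_i + 1\<close> with \<open>i\<close> at least 2.\<close>

fun gap_product :: "nat \<Rightarrow> nat list \<Rightarrow> nat" where
  "gap_product b [] = 1"
| "gap_product b (c # cs) = (c - b + 1) * gap_product c cs"

text \<open>The first factor is \<open>k_1 + 1\<close>: a 0-based position \<open>b\<close> has
  \<open>b + 1\<close> vertices up to and including it, and \<open>j\<close> more were passed before
  the list begins.\<close>

fun position_weight :: "nat \<Rightarrow> nat list \<Rightarrow> nat" where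
  "position_weight j [] = 1"
| "position_weight j (b # bs) = (b + j + 2) * gap_product b bs"

section \<open>Path weights as products over segments\<close>

lemma gap_product_map_Suc: "gap_product (Suc b) (map Suc bs) = gap_product b bs"
  by (induction bs arbitrary: b) auto

lemma gap_product_eq_prod:
  "gap_product b bs = (\<Prod>i<length bs. bs ! i - (b # bs) ! i + 1)"
  by (induction bs arbitrary: b) (auto simp: prod.lessThan_Suc_shift simp del: prod.lessThan_Suc)

lemma nondegenerate_positions_Cons:
  "nondegenerate_positions F (v # P) =
    (if degenerate F v then map Suc (nondegenerate_positions F P)
     else 0 # map Suc (nondegenerate_positions F P))"
proof -
  have "[0..<length (v # P)] = 0 # map Suc [0..<length P]"
    by (simp add: upt_conv_Cons map_Suc_upt del: upt_Suc)
  then show ?thesis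
    by (simp add: nondegenerate_positions_def filter_map o_def del: upt_Suc)
qed

lemma length_nondegenerate_positions:
  "length (nondegenerate_positions F P) = length (filter (\<lambda>v. \<not> degenerate F v) P)"
proof (induction P)
  case Nil
  then show ?case by (simp add: nondegenerate_positions_def)
next
  case (Cons v P)
  then show ?case by (simp add: nondegenerate_positions_Cons)
qed

text \<open>Passing a degenerate vertex lowers the next position by one and raises \<open>j\<close>
  by one, so \<open>b + j + 2\<close> is invariant. Passing a non-degenerate vertex turns the next
  gap into a first factor with \<open>j = 0\<close>.\<close>

lemma path_weight_eq_position_weight:
  "path_weight (degenerate F) j P = position_weight j (nondegenerate_positions F P)"
proof (induction P arbitrary: j)
  case Nil
  then show ?case by (simp add: nondegenerate_positions_def)
next
  case (Cons v P)
  show ?case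
    by (cases "nondegenerate_positions F P")
      (auto simp: nondegenerate_positions_Cons Cons.IH gap_product_map_Suc)
qed

lemma prod_segment_length:
  assumes "length (nondegenerate_positions F P) \<le> h"
  shows "(\<Prod>i = 1..h. segment_length F P i + 1) = path_weight (degenerate F) 0 P"
proof -
  define bs where "bs = nondegenerate_positions F P"
  \<comment> \<open>Beyond the last non-degenerate vertex the segment length is 0 by convention, so
    these factors are 1.\<close>
  have "(\<Prod>i = 1..h. segment_length F P i + 1) = (\<Prod>i = 1..length bs. segment_length F P i + 1)"
    using assms by (intro prod.mono_neutral_right) (auto simp: bs_def segment_length_def Let_def not_le)
  also have "\<dots> = position_weight 0 bs"
  proof (cases bs)
    case Nil
    then show ?thesis by simp
  next
    case (Cons b cs)
    have first: "segment_length F P 1 + 1 = b + 2"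
      using Cons by (simp add: segment_length_def Let_def bs_def[symmetric])
    have rest: "segment_length F P (i + 2) + 1 = cs ! i - (b # cs) ! i + 1" if "i < length cs" for i
      using Cons that by (simp add: segment_length_def Let_def bs_def[symmetric])
    have "(\<Prod>i = 1..length bs. segment_length F P i + 1) =
        (\<Prod>i<Suc (length cs). segment_length F P (Suc i) + 1)"
      using Cons by (simp only: One_nat_def prod.atLeast1_atMost_eq list.size add_Suc_right add_0_right)
    also have "\<dots> = (b + 2) * (\<Prod>i<length cs. segment_length F P (i + 2) + 1)"
      unfolding prod.lessThan_Suc_shift using first by simp
    also have "(\<Prod>i<length cs. segment_length F P (i + 2) + 1) = gap_product b cs"
      unfolding gap_product_eq_prod using rest by (intro prod.cong) auto
    finally show ?thesis using Cons by simp
  qed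
  finally show ?thesis by (simp add: path_weight_eq_position_weight bs_def)
qed

lemma path_weight_pos: "0 < path_weight d j P"
  by (induction P arbitrary: j) auto

section \<open>Tree structure derived from unique walks\<close>

lemma rooted_tree_finite:
  assumes "rooted_tree F r"
  shows "finite (parcs F)" "finite (pverts F)"
  using assms pair_fin_digraph.pair_finite_arcs pair_fin_digraph.pair_finite_verts
  unfolding rooted_tree_def by blast+

lemma rooted_tree_arc_verts:
  assumes "rooted_tree F r" "(u, v) \<in> parcs F"
  shows "u \<in> pverts F" "v \<in> pverts F"
proof -
  interpret pair_fin_digraph F using assms(1) by (simp add: rooted_tree_def)
  show "u \<in> pverts F" "v \<in> pverts F" using assms(2) wellformed' by blast+
qed

lemma rooted_tree_reachable_root:
  assumes "rooted_tree F r" "v \<in> pverts F"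
  shows "(r, v) \<in> (parcs F)\<^sup>*"
proof -
  interpret pair_fin_digraph F using assms(1) by (simp add: rooted_tree_def)
  have "\<exists>p. awalk r p v" using assms by (auto simp: rooted_tree_def)
  then have "reachable (with_proj F) r v" by (simp add: reachable_awalk)
  then show ?thesis using reachable_rtranclI[of "with_proj F" r v] by simp
qed

text \<open>Extending root walks to \<open>u\<close> and \<open>v\<close> by their arcs to
  \<open>w\<close> gives two walks to \<open>w\<close>; by uniqueness these have the same last
  arc.\<close>

lemma rooted_tree_unique_parent:
  assumes T: "rooted_tree F r" and e: "(u, w) \<in> parcs F" "(v, w) \<in> parcs F"
  shows "u = v"
proof -
  interpret pair_fin_digraph F using T by (simp add: rooted_tree_def)
  have uniq: "\<exists>!p. awalk r p x" if "x \<in> pverts F" for x using T that by (simp add: rooted_tree_def)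
  obtain p q where p: "awalk r p u" and q: "awalk r q v"
    using uniq wellformed' e by meson
  have "awalk r (p @ [(u, w)]) w" "awalk r (q @ [(v, w)]) w"
    using p q e awalk_appendI[OF p, of "[(u,w)]" w] awalk_appendI[OF q, of "[(v,w)]" w]
      arc_implies_awalk[OF e(1)] arc_implies_awalk[OF e(2)] by auto
  then show ?thesis using uniq wellformed' e by blast
qed

text \<open>A cycle through \<open>v\<close> could be appended to the walk from the root to
  \<open>v\<close>, giving a second one.\<close>

lemma rooted_tree_acyclic:
  assumes T: "rooted_tree F r"
  shows "acyclic (parcs F)"
proof (rule acyclicI, intro allI notI)
  fix v assume "(v, v) \<in> (parcs F)\<^sup>+"
  then obtain w where w: "(v, w) \<in> parcs F" "(w, v) \<in> (parcs F)\<^sup>*" by (meson tranclD)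
  interpret pair_fin_digraph F using T by (simp add: rooted_tree_def)
  have v: "v \<in> pverts F" "w \<in> pverts F" using w wellformed' by auto
  then have uniq: "\<exists>!p. awalk r p v" using T by (simp add: rooted_tree_def)
  then obtain p where p: "awalk r p v" by blast
  have "reachable (with_proj F) w v" using w v by (simp add: reachable_conv)
  then obtain q where q: "awalk w q v" using reachable_awalk by auto
  have "awalk v ((v, w) # q) v" using q w by (simp add: awalk_Cons_iff)
  then have "awalk r (p @ (v, w) # q) v" using p by (rule awalk_appendI[rotated])
  then show False using uniq p by (metis append_self_conv list.distinct(1))
qed

text \<open>With unique parents the ancestors of \<open>u\<close> form a chain, so one of the two
  siblings would be an ancestor of the other. The path between them would pass through the common
  parent \<open>v\<close> and close a cycle.\<close>

lemma disjoint_subtrees: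
  assumes acyc: "acyclic E" and par: "\<And>u v w. (u, w) \<in> E \<Longrightarrow> (v, w) \<in> E \<Longrightarrow> u = v"
    and e: "(v, w1) \<in> E" "(v, w2) \<in> E" "w1 \<noteq> w2"
    and u: "(w1, u) \<in> E\<^sup>*" "(w2, u) \<in> E\<^sup>*"
  shows False
proof -
  have "single_valued (E\<inverse>)" using par by (auto simp: single_valued_def)
  moreover have "(u, w1) \<in> (E\<inverse>)\<^sup>*" "(u, w2) \<in> (E\<inverse>)\<^sup>*" using u by (auto simp: rtrancl_converse)
  ultimately have "(w1, w2) \<in> (E\<inverse>)\<^sup>* \<or> (w2, w1) \<in> (E\<inverse>)\<^sup>*" by (rule single_valued_confluent)
  then have comparable: "(w1, w2) \<in> E\<^sup>* \<or> (w2, w1) \<in> E\<^sup>*" by (auto simp: rtrancl_converse)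
  have absurd: False if w: "(v, w) \<in> E" "(v, w') \<in> E" "w \<noteq> w'" "(w, w') \<in> E\<^sup>*" for w w'
  proof -
    obtain z where "(w, z) \<in> E\<^sup>*" "(z, w') \<in> E"
      using w(3,4) by (meson rtranclD tranclD2)
    then have "(v, v) \<in> E\<^sup>+" using par w by (metis rtrancl_into_trancl2)
    then show False using acyc by (simp add: acyclic_def)
  qed
  show False using comparable absurd e by blast
qed

section \<open>Paths from a vertex down to a leaf\<close>

lemma vwalk_reachable_from_hd:
  assumes "vwalk P (with_proj F)" "x \<in> set P"
  shows "(hd P, x) \<in> (parcs F)\<^sup>*"
  using assms by (induction rule: vwalk_induct) (auto intro: converse_rtrancl_into_rtrancl)

lemma out_arcs_with_proj: "out_arcs (with_proj F) v = Pair v ` (parcs F `` {v})"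
  by (auto simp: out_arcs_def)

lemma out_degree_with_proj: "out_degree (with_proj F) v = card (parcs F `` {v})"
  by (simp add: out_degree_def out_arcs_with_proj card_image inj_on_def)

lemma root_leaf_paths_leaf:
  assumes "v \<in> pverts F" "parcs F `` {v} = {}"
  shows "[v] \<in> root_leaf_paths F v"
  using assms by (simp add: root_leaf_paths_def out_degree_with_proj vpath_def vwalk_def)

lemma root_leaf_paths_child:
  assumes "rooted_tree F r" "(v, w) \<in> parcs F" "P \<in> root_leaf_paths F w"
  shows "v # P \<in> root_leaf_paths F v"
proof -
  have P: "vwalk P (with_proj F)" "distinct P" "hd P = w" "P \<noteq> []"
      "out_degree (with_proj F) (last P) = 0"
    using assms(3) by (auto simp: root_leaf_paths_def vpath_def vwalk_def)
  have "v \<notin> set P"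
  proof
    assume "v \<in> set P"
    then have "(w, v) \<in> (parcs F)\<^sup>*" using vwalk_reachable_from_hd[OF P(1)] P(3) by simp
    then have "(v, v) \<in> (parcs F)\<^sup>+" using assms(2) by (rule rtrancl_into_trancl2[rotated])
    then show False using rooted_tree_acyclic[OF assms(1)] by (simp add: acyclic_def)
  qed
  moreover have "vwalk (v # P) (with_proj F)"
    using P assms rooted_tree_arc_verts by (intro vwalk_consI) auto
  ultimately show ?thesis using P by (auto simp: root_leaf_paths_def vpath_def)
qed

lemma root_leaf_paths_ConsE:
  assumes "P \<in> root_leaf_paths F v"
  obtains Q where "P = v # Q"
  using assms by (cases P) (auto simp: root_leaf_paths_def vpath_def vwalk_def)

lemma finite_root_leaf_paths:
  assumes "finite (pverts F)"
  shows "finite (root_leaf_paths F v)"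
proof (rule finite_subset)
  show "root_leaf_paths F v \<subseteq> {P. set P \<subseteq> pverts F \<and> length P \<le> card (pverts F)}"
  proof
    fix P assume "P \<in> root_leaf_paths F v"
    then have "set P \<subseteq> pverts F" "distinct P"
      by (auto simp: root_leaf_paths_def vpath_def vwalk_def)
    then show "P \<in> {P. set P \<subseteq> pverts F \<and> length P \<le> card (pverts F)}"
      using card_mono[OF assms, of "set P"] distinct_card[of P] by simp
  qed
  show "finite \<dots>" using assms by (rule finite_lists_length_le)
qed

section \<open>The induction over the tree\<close>

lemma degenerate_iff: "degenerate F v \<longleftrightarrow> (\<exists>w. parcs F `` {v} = {w})"
  by (simp add: degenerate_def out_degree_with_proj card_1_singleton_iff)

text \<open>With \<open>Y = 3 * D * int K\<close>, the factor \<open>B\<close> is at most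
  \<open>Y ^ (L - 1)\<close> and the base of the power is at most \<open>Y * B\<close>. The
  exponents add up to \<open>(L - 1) + k + (L - 1) * k = (k + 1) * L - 1\<close>, which is at most
  \<open>K - 1\<close>.\<close>

lemma graver_bound_arith:
  fixes D :: int
  assumes "1 \<le> D" "1 \<le> L" "t \<le> k" "1 \<le> k" "Suc k * L \<le> K"
  defines "B \<equiv> (3 * D * int L) ^ (L - 1)"
  shows "B * (2 * int t * D * B + 1) ^ t \<le> (3 * D * int K) ^ (K - 1)"
proof -
  define Y where "Y = 3 * D * int K"
  obtain l where l: "L = Suc l" using assms(2) by (cases L) auto
  then have exponent: "L - 1 + k + (L - 1) * k \<le> K - 1" "k \<le> K" "L \<le> K"
    using assms(5) by (simp_all add: algebra_simps)
  have LK: "3 * D * int L \<le> Y" "1 \<le> 3 * D * int L" "3 * int k * D \<le> Y" "1 \<le> Y"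
  proof -
    show "3 * D * int L \<le> Y" using exponent(3) assms(1) by (simp add: Y_def)
    show "3 * int k * D \<le> Y" using exponent(2) assms(1) by (simp add: Y_def)
    have "1 * 1 \<le> D * int L" using assms(1,2) by (intro mult_mono) auto
    then show "1 \<le> 3 * D * int L" by simp
    then show "1 \<le> Y" using \<open>3 * D * int L \<le> Y\<close> by simp
  qed
  have B: "1 \<le> B" "B \<le> Y ^ (L - 1)"
    using LK by (auto simp: B_def intro: power_mono)
  \<comment> \<open>This absorbs the summand 1 into \<open>3 * int k * D * B\<close>, which is where
    the factor 3 comes from.\<close>
  have kDB: "1 \<le> int k * D * B" using B assms(1,4)
    by (smt (verit) mult_pos_pos of_nat_le_iff of_nat_1)
  have "2 * int t * D * B \<le> 2 * int k * D * B"
    using assms(1,3) B by (intro mult_right_mono) auto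
  then have "2 * int t * D * B + 1 \<le> 3 * int k * D * B" using kDB by (simp add: algebra_simps)
  then have "(2 * int t * D * B + 1) ^ t \<le> (3 * int k * D * B) ^ t"
    using B assms(1) by (intro power_mono) auto
  also have "\<dots> \<le> (3 * int k * D * B) ^ k"
    using kDB assms(3) by (intro power_increasing) (auto simp: algebra_simps)
  also have "\<dots> = (3 * int k * D) ^ k * B ^ k" by (rule power_mult_distrib)
  also have "\<dots> \<le> Y ^ k * (Y ^ (L - 1)) ^ k"
    using LK B assms(1) by (intro mult_mono power_mono) auto
  finally have "B * (2 * int t * D * B + 1) ^ t \<le> Y ^ (L - 1) * (Y ^ k * (Y ^ (L - 1)) ^ k)"
    using B LK assms(1) by (intro mult_mono) auto
  also have "\<dots> = Y ^ ((L - 1) + k + (L - 1) * k)"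
    by (simp add: power_add power_mult mult.assoc)
  also have "\<dots> \<le> Y ^ (K - 1)"
    using exponent(1) LK(4) by (rule power_increasing)
  finally show ?thesis by (simp add: Y_def)
qed

text \<open>The rows \<open>T\<close> collect the degenerate vertices above \<open>v\<close>, which are only eliminated together
  with the next non-degenerate vertex.\<close>

lemma graver_bound_subtree:
  fixes a :: "'v \<Rightarrow> 'c \<Rightarrow> int"
  assumes tree: "rooted_tree F r" and C: "finite C" and "1 \<le> D"
    and D: "\<forall>u\<in>pverts F. \<forall>c\<in>C. \<bar>a u c\<bar> \<le> D"
    and comparable: "\<forall>u\<in>pverts F. \<forall>v\<in>pverts F. \<forall>c\<in>C. a u c \<noteq> 0 \<longrightarrow> a v c \<noteq> 0 \<longrightarrow>
      (u, v) \<in> (parcs F)\<^sup>* \<or> (v, u) \<in> (parcs F)\<^sup>*"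
    and "v \<in> pverts F"
  shows "root_leaf_paths F v \<noteq> {} \<and>
    (\<forall>T j K x. T \<subseteq> pverts F \<longrightarrow> card T \<le> j \<longrightarrow>
      (\<forall>P\<in>root_leaf_paths F v. path_weight (degenerate F) j P \<le> K) \<longrightarrow>
      x \<in> graver a C ((parcs F)\<^sup>* `` {v} \<union> T) \<longrightarrow> l1 C x \<le> (3 * D * int K) ^ (K - 1))"
proof -
  define E where "E = parcs F"
  define V where "V = pverts F"
  have arc_verts: "w \<in> V" if "(u, w) \<in> E" for u w
    using rooted_tree_arc_verts(2)[OF tree] that by (simp add: E_def V_def)
  have path_child: "u # P \<in> root_leaf_paths F u" if "(u, w) \<in> E" "P \<in> root_leaf_paths F w" for u w P
    using root_leaf_paths_child[OF tree] that by (simp add: E_def)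
  have acyclic: "acyclic E" and parent: "\<And>u v w. (u, w) \<in> E \<Longrightarrow> (v, w) \<in> E \<Longrightarrow> u = v"
    using rooted_tree_acyclic[OF tree] rooted_tree_unique_parent[OF tree] by (simp_all add: E_def)
  have "finite E" using rooted_tree_finite(1)[OF tree] by (simp add: E_def)
  \<comment> \<open>The induction runs from the leaves to the root: the hypothesis is available for
    the children of \<open>v\<close>.\<close>
  then have "wf (E\<inverse>)" using acyclic by (rule finite_acyclic_wf_converse)
  then show ?thesis using \<open>v \<in> pverts F\<close> unfolding E_def[symmetric] V_def[symmetric]
  proof (induction v rule: wf_induct_rule)
    case (less v)
    have vF: "v \<in> V" by fact
    have child_verts: "w \<in> V" if "(v, w) \<in> E" for w
      using arc_verts that by blast
    \<comment> \<open>A path below \<open>v\<close> is needed to know that \<open>K\<close> is at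
      least \<open>j + 2\<close>, so that the quotient \<open>L\<close> below is positive.\<close>
    have ne: "root_leaf_paths F v \<noteq> {}"
    proof (cases "E `` {v} = {}")
      case True then show ?thesis using root_leaf_paths_leaf[of v F] vF by (auto simp: E_def V_def)
    next
      case False
      then obtain w where "(v, w) \<in> E" by blast
      then show ?thesis using less.IH[of w] child_verts path_child by blast
    qed
    have desc: "E\<^sup>* `` {v} = insert v (\<Union>w\<in>E `` {v}. E\<^sup>* `` {w})"
      by (auto elim: converse_rtranclE intro: converse_rtrancl_into_rtrancl)
    have desc_verts: "E\<^sup>* `` {w} \<subseteq> V" if "(v, w) \<in> E" for w
    proof
      fix u assume "u \<in> E\<^sup>* `` {w}"
      then have "(w, u) \<in> E\<^sup>*" by simp
      then show "u \<in> V"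
        by (cases rule: rtrancl.cases) (use child_verts that arc_verts in blast)+
    qed
    have "l1 C x \<le> (3 * D * int K) ^ (K - 1)"
      if T: "T \<subseteq> V" "card T \<le> j"
        and K: "\<forall>P\<in>root_leaf_paths F v. path_weight (degenerate F) j P \<le> K"
        and x: "x \<in> graver a C (E\<^sup>* `` {v} \<union> T)" for T j K x
    proof -
      have finT: "finite T" using T(1) rooted_tree_finite(2)[OF tree] by (simp add: V_def finite_subset)
      have cT: "card (insert v T) \<le> Suc j" using T(2) finT by (simp add: card_insert_if)
      show ?thesis
      proof (cases "degenerate F v")
        case True
        \<comment> \<open>Nothing is eliminated at a degenerate vertex: \<open>v\<close> joins
          \<open>T\<close>, the counter rises by one, and the row set and path weights are those of
          the only child.\<close>
        then obtain w where w: "E `` {v} = {w}" by (auto simp: degenerate_iff E_def)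
        then have vw: "(v, w) \<in> E" by blast
        have "path_weight (degenerate F) (Suc j) P \<le> K" if "P \<in> root_leaf_paths F w" for P
          using K path_child[OF vw that] True by fastforce
        moreover have "x \<in> graver a C (E\<^sup>* `` {w} \<union> insert v T)"
          using x desc w by simp
        moreover have "insert v T \<subseteq> V" using T vF by simp
        ultimately show ?thesis
          using less.IH[of w] vw child_verts cT by blast
      next
        case False
        \<comment> \<open>Every path from \<open>v\<close> contributes the factor
          \<open>j + 2\<close> here, so the paths from the children have weight at most this
          quotient.\<close>
        define L where "L = K div (j + 2)"
        define B where "B = (3 * D * int L) ^ (L - 1)"
        obtain P where P: "P \<in> root_leaf_paths F v" using ne by blast
        then obtain Q where "P = v # Q" by (rule root_leaf_paths_ConsE)
        then have "(j + 2) * path_weight (degenerate F) 0 Q \<le> K" using K P False by fastforce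
        then have "j + 2 \<le> K" using path_weight_pos[of "degenerate F" 0 Q]
          by (metis le_trans mult_le_mono2 nat_mult_1_right Suc_leI One_nat_def)
        then have "1 \<le> L" by (simp add: L_def div_greater_zero_iff Suc_leI)
        then have "1 \<le> 3 * D * int L" using \<open>1 \<le> D\<close> by (smt (verit) mult_pos_pos of_nat_1 of_nat_le_iff)
        then have "1 \<le> B" by (simp add: B_def)
        have block: "l1 C g \<le> B" if w: "w \<in> E `` {v}" and g: "g \<in> graver a C (E\<^sup>* `` {w})" for w g
        proof -
          have vw: "(v, w) \<in> E" using w by blast
          have "path_weight (degenerate F) 0 P \<le> L" if "P \<in> root_leaf_paths F w" for P
          proof -
            have "(j + 2) * path_weight (degenerate F) 0 P \<le> K"
              using K path_child[OF vw that] False by fastforce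
            then show ?thesis by (simp add: L_def less_eq_div_iff_mult_less_eq mult.commute)
          qed
          \<comment> \<open>The children start afresh with \<open>T = {}\<close> and counter
            0.\<close>
          moreover have "g \<in> graver a C (E\<^sup>* `` {w} \<union> {})" using g by simp
          ultimately show ?thesis
            unfolding B_def using less.IH[of w] vw child_verts by (metis card.empty converse_iff empty_subsetI le_refl)
        qed
        have "\<forall>g\<in>graver a C (\<Union>w\<in>E `` {v}. E\<^sup>* `` {w}). l1 C g \<le> B"
        proof
          fix g assume g: "g \<in> graver a C (\<Union>w\<in>E `` {v}. E\<^sup>* `` {w})"
          show "l1 C g \<le> B"
          proof (rule graver_bound_blocks[OF C _ block \<open>1 \<le> B\<close> g])
            fix w1 w2 u1 u2 c
            assume w: "w1 \<in> E `` {v}" "w2 \<in> E `` {v}" "w1 \<noteq> w2"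
              and u: "u1 \<in> E\<^sup>* `` {w1}" "u2 \<in> E\<^sup>* `` {w2}" and c: "c \<in> C"
            \<comment> \<open>Rows in different child subtrees sharing a nonzero column would be
              comparable in the tree, and the lower one would descend from both children.\<close>
            have no_common: False if "(w1, u) \<in> E\<^sup>*" "(w2, u) \<in> E\<^sup>*" for u
              by (rule disjoint_subtrees[OF acyclic, of v w1 w2 u]) (use parent w that in blast)+
            show "a u1 c = 0 \<or> a u2 c = 0"
            proof (rule ccontr)
              assume "\<not> ?thesis"
              then have "(u1, u2) \<in> E\<^sup>* \<or> (u2, u1) \<in> E\<^sup>*"
                using comparable u w c desc_verts unfolding E_def V_def by blast
              then show False using no_common u by (meson Image_singleton_iff rtrancl_trans)
            qed
          qed
        qed
        moreover have "x \<in> graver a C ((\<Union>w\<in>E `` {v}. E\<^sup>* `` {w}) \<union> insert v T)"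
          using x desc by simp
        moreover have "\<forall>u\<in>insert v T. \<forall>c\<in>C. \<bar>a u c\<bar> \<le> D" using D T vF unfolding V_def by blast
        ultimately have "l1 C x \<le> B * (2 * int (card (insert v T)) * D * B + 1) ^ card (insert v T)"
          using C finT \<open>1 \<le> D\<close> \<open>1 \<le> B\<close> by (intro graver_bound_add_rows) auto
        also have "\<dots> \<le> (3 * D * int K) ^ (K - 1)"
          unfolding B_def
        proof (rule graver_bound_arith[OF \<open>1 \<le> D\<close> \<open>1 \<le> L\<close> cT])
          show "Suc (Suc j) * L \<le> K"
            using times_div_less_eq_dividend[of "Suc (Suc j)" K] by (simp only: L_def add_2_eq_Suc')
        qed simp
        finally show ?thesis .
      qed
    qed
    then show ?case using ne by blast
  qed
qed

section \<open>The bound for matrices\<close>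

lemma mat_kernel_iff_row_sums:
  fixes A :: "'a::comm_ring_1 mat"
  assumes "A \<in> carrier_mat m n"
  shows "x \<in> mat_kernel A \<longleftrightarrow> dim_vec x = n \<and> (\<forall>i<m. (\<Sum>c<n. A $$ (i, c) * x $ c) = 0)"
proof -
  have "A *\<^sub>v x = 0\<^sub>v m \<longleftrightarrow> (\<forall>i<m. (\<Sum>c<n. A $$ (i, c) * x $ c) = 0)" if "dim_vec x = n"
    using assms that
    by (auto simp: vec_eq_iff scalar_prod_def lessThan_atLeast0 cong: sum.cong_simp)
  then show ?thesis unfolding mat_kernel[OF assms] carrier_vec_def by blast
qed

text \<open>A kernel function \<open>h\<close> below the zero extension \<open>x\<close> gives the
  vector \<open>vec n h\<close> below \<open>g\<close>, so minimality of \<open>g\<close> yields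
  \<open>h = x\<close>.\<close>

lemma graver_basis_imp_graver:
  assumes A: "A \<in> carrier_mat m n" and g: "g \<in> graver_basis A"
  defines "x \<equiv> (\<lambda>c. if c < n then g $ c else 0)"
  shows "x \<in> graver (\<lambda>i c. A $$ (i, c)) {..<n} {..<m}" "l1 {..<n} x = l1_norm_vec g"
proof -
  have g': "g \<in> mat_kernel A" "g \<noteq> 0\<^sub>v n"
    and min: "\<And>h. h \<in> mat_kernel A \<Longrightarrow> h \<noteq> 0\<^sub>v n \<Longrightarrow> conformal_le h g \<Longrightarrow> h = g"
    using g A by (auto simp: graver_basis_def Let_def)
  have dim: "dim_vec g = n" using g'(1) mat_kernel_iff_row_sums[OF A] by blast
  show "l1 {..<n} x = l1_norm_vec g" by (simp add: l1_def l1_norm_vec_def dim x_def)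
  show "x \<in> graver (\<lambda>i c. A $$ (i, c)) {..<n} {..<m}"
    unfolding graver_def
  proof (intro CollectI conjI ballI impI)
    show "x \<in> row_kernel (\<lambda>i c. A $$ (i, c)) {..<n} {..<m}"
      using g'(1) by (simp add: mat_kernel_iff_row_sums[OF A] row_kernel_def x_def)
    show "x \<noteq> (\<lambda>_. 0)"
    proof
      assume eq: "x = (\<lambda>_. 0)"
      have "g $ c = 0" if "c < n" for c using that fun_cong[OF eq, of c] by (simp add: x_def)
      then show False using g'(2) dim by auto
    qed
    fix h assume h: "h \<in> row_kernel (\<lambda>i c. A $$ (i, c)) {..<n} {..<m}" "h \<noteq> (\<lambda>_. 0)" "conformal h x"
    have supp: "h c = 0" if "\<not> c < n" for c using h(1) that by (simp add: row_kernel_def)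
    have "vec n h \<in> mat_kernel A"
      using h(1) by (simp add: mat_kernel_iff_row_sums[OF A] row_kernel_def)
    moreover have "vec n h \<noteq> 0\<^sub>v n"
    proof
      assume eq: "vec n h = 0\<^sub>v n"
      have "h c = 0" for c
      proof (cases "c < n")
        case True
        then show ?thesis using arg_cong[OF eq, of "\<lambda>v. v $ c"] by simp
      qed (rule supp)
      then show False using h(2) by auto
    qed
    moreover have "conformal_le (vec n h) g"
    proof -
      have "0 \<le> h c * g $ c \<and> \<bar>h c\<bar> \<le> \<bar>g $ c\<bar>" if "c < n" for c
      proof -
        have "(0 \<le> h c \<and> h c \<le> g $ c) \<or> (g $ c \<le> h c \<and> h c \<le> 0)"
          using h(3) that by (auto simp: conformal_def x_def dest: spec[of _ c])
        then show ?thesis by (auto intro: mult_nonneg_nonneg mult_nonpos_nonpos)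
      qed
      then show ?thesis by (simp add: conformal_le_def dim)
    qed
    ultimately have eq: "vec n h = g" by (rule min)
    show "h = x"
    proof
      fix c
      show "h c = x c"
      proof (cases "c < n")
        case True
        then have "vec n h $ c = h c" by simp
        then show ?thesis using True eq by (simp add: x_def)
      qed (simp add: x_def supp)
    qed
  qed
qed

lemma abs_le_linf_norm_mat:
  assumes "i < dim_row A" "j < dim_col A"
  shows "\<bar>A $$ (i, j)\<bar> \<le> linf_norm_mat A"
  unfolding linf_norm_mat_def
proof (rule Max_ge)
  show "finite (abs ` elements_mat A)" by (simp add: elements_mat_def)
  have "A $$ (i, j) \<in> elements_mat A" using assms by (intro elements_matI[of A "dim_row A" "dim_col A"]) auto
  then show "\<bar>A $$ (i, j)\<bar> \<in> abs ` elements_mat A" by blast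
qed

lemma linf_norm_mat_pos:
  assumes "A \<in> carrier_mat m n" "A \<noteq> 0\<^sub>m m n"
  shows "1 \<le> linf_norm_mat A"
proof -
  obtain i j where "i < m" "j < n" "A $$ (i, j) \<noteq> 0"
    using assms eq_matI[of "0\<^sub>m m n" A] by fastforce
  then show ?thesis using assms(1) abs_le_linf_norm_mat[of i A j] by fastforce
qed

text \<open>The bound itself confines the norms to \<open>{0..N}\<close>, which supplies the
  finiteness behind \<open>Max\<close>; \<open>0 \<le> N\<close> covers the empty Graver
  basis.\<close>

lemma g1_le:
  assumes "\<And>g. g \<in> graver_basis A \<Longrightarrow> l1_norm_vec g \<le> N" "0 \<le> N"
  shows "g1 A \<le> N"
proof (cases "graver_basis A = {}")
  case True
  then show ?thesis using assms(2) by (simp add: g1_def)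
next
  case False
  have "l1_norm_vec ` graver_basis A \<subseteq> {0..N}"
    using assms(1) by (auto simp: l1_norm_vec_def sum_nonneg)
  then have "finite (l1_norm_vec ` graver_basis A)" by (rule finite_subset) simp
  then show ?thesis using False assms(1) by (simp add: g1_def)
qed

theorem lemma30:
  fixes A :: "int mat" and m n :: nat
    and F :: "nat pair_pre_digraph" and r :: nat and K :: nat
  assumes "A \<in> carrier_mat m n"
    and "A \<noteq> 0\<^sub>m m n"
    and "Digraph_Component.connected (with_proj (dual_graph A))"
    and "td_decomposition (dual_graph A) F r"
    and "K = Max ((\<lambda>P. \<Prod>i = 1..topological_height F r. (segment_length F P i + 1))
                    ` root_leaf_paths F r)"
  shows "g1 A \<le> (3 * linf_norm_mat A * int K) ^ (K - 1)"
proof -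
  let ?a = "\<lambda>i c. A $$ (i, c)"
  note A = assms(1)
  have tree: "rooted_tree F r" and verts: "pverts F = {..<m}"
    and td: "\<And>u v. (u, v) \<in> parcs (dual_graph A) \<Longrightarrow>
      reachable (with_proj F) u v \<or> reachable (with_proj F) v u"
    using assms(4) A by (auto simp: td_decomposition_def dual_graph_def)
  have pos: "1 \<le> linf_norm_mat A" using linf_norm_mat_pos assms by blast
  have fin: "finite (root_leaf_paths F r)"
    by (rule finite_root_leaf_paths[OF rooted_tree_finite(2)[OF tree]])
  have weight: "path_weight (degenerate F) 0 P \<le> K" if P: "P \<in> root_leaf_paths F r" for P
  proof -
    \<comment> \<open>The topological height is a maximum over all paths, so a shorter path only
      gains factors 1 and its product is its path weight.\<close>
    have "length (nondegenerate_positions F P) \<le> topological_height F r"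
      using P fin by (auto simp: topological_height_def length_nondegenerate_positions)
    then have "path_weight (degenerate F) 0 P =
        (\<Prod>i = 1..topological_height F r. segment_length F P i + 1)"
      by (rule prod_segment_length[symmetric])
    then show ?thesis unfolding assms(5) using P fin by (intro Max_ge) auto
  qed
  have comparable: "\<forall>u\<in>pverts F. \<forall>v\<in>pverts F. \<forall>c\<in>{..<n}. ?a u c \<noteq> 0 \<longrightarrow> ?a v c \<noteq> 0 \<longrightarrow>
      (u, v) \<in> (parcs F)\<^sup>* \<or> (v, u) \<in> (parcs F)\<^sup>*"
  proof (intro ballI impI)
    fix u v c
    assume uv: "u \<in> pverts F" "v \<in> pverts F" "c \<in> {..<n}" "?a u c \<noteq> 0" "?a v c \<noteq> 0"
    show "(u, v) \<in> (parcs F)\<^sup>* \<or> (v, u) \<in> (parcs F)\<^sup>*"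
    proof (cases "u = v")
      case False
      then have "(u, v) \<in> parcs (dual_graph A)"
        using uv verts A by (auto simp: dual_graph_def)
      then have "reachable (with_proj F) u v \<or> reachable (with_proj F) v u" by (rule td)
      then show ?thesis
        using reachable_rtranclI[of "with_proj F" u v] reachable_rtranclI[of "with_proj F" v u] by auto
    qed simp
  qed
  have entries: "\<forall>u\<in>pverts F. \<forall>c\<in>{..<n}. \<bar>?a u c\<bar> \<le> linf_norm_mat A"
    using verts A abs_le_linf_norm_mat[of _ A] by simp
  have root: "r \<in> pverts F" using tree by (simp add: rooted_tree_def)
  have desc: "(parcs F)\<^sup>* `` {r} = {..<m}"
  proof
    show "{..<m} \<subseteq> (parcs F)\<^sup>* `` {r}"
      using rooted_tree_reachable_root[OF tree] verts by auto
    show "(parcs F)\<^sup>* `` {r} \<subseteq> {..<m}"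
    proof
      fix v assume "v \<in> (parcs F)\<^sup>* `` {r}"
      then have "(r, v) \<in> (parcs F)\<^sup>*" by simp
      then show "v \<in> {..<m}"
        by (cases rule: rtrancl.cases) (use rooted_tree_arc_verts(2)[OF tree] root verts in auto)
    qed
  qed
  have bound: "l1 {..<n} x \<le> (3 * linf_norm_mat A * int K) ^ (K - 1)"
    if "x \<in> graver ?a {..<n} {..<m}" for x
  proof -
    \<comment> \<open>The induction result is applied at the root, with no rows collected above it
      and counter 0.\<close>
    have "x \<in> graver ?a {..<n} ((parcs F)\<^sup>* `` {r} \<union> {})" using that desc by simp
    moreover have "\<forall>P\<in>root_leaf_paths F r. path_weight (degenerate F) 0 P \<le> K"
      using weight by blast
    ultimately show ?thesis
      using conjunct2[OF graver_bound_subtree[OF tree finite_lessThan[of n] pos entries comparable root],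
        rule_format, of "{}" 0 K x] by simp
  qed
  show ?thesis
  proof (rule g1_le)
    fix g assume "g \<in> graver_basis A"
    then show "l1_norm_vec g \<le> (3 * linf_norm_mat A * int K) ^ (K - 1)"
      using bound graver_basis_imp_graver[OF A] by metis
  next
    show "0 \<le> (3 * linf_norm_mat A * int K) ^ (K - 1)" using pos by simp
  qed
qed

end
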